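(* Let $\mathcal{H}_K$ be a reproducing kernel Hilbert space of functions $f:\Omega\to\mathbb{C}$ with reproducing kernel $K$ satisfying $K(z,z)>0$ for every $z\in\Omega$, and let $\{\psi_i\}_{i\in\mathcal{I}}\subset\mathcal{H}_K$ be a countable family. (i) If $\{\psi_i\}_{i\in\mathcal{I}}$ is Bessel with bound $M$, i.e. $\sum_{i\in\mathcal{I}}|\langle f,\psi_i\rangle|^2\le M\|f\|^2$ for all $f\in\mathcal{H}_K$, then $$\frac{\sum_{i\in\mathcal{I}}|\psi_i(z)|^2}{K(z,z)}\le M,\qquad\forall z\in\Omega.$$ (ii) If $\{\psi_i\}_{i\in\mathcal{I}}$ satisfies the lower frame inequality with bound $m>0$, i.e. $m\|f\|^2\le\sum_{i\in\mathcal{I}}|\langle f,\psi_i\rangle|^2$ for all $f\in\mathcal{H}_K$, then $$0<m\le\frac{\sum_{i\in\mathcal{I}}|\psi_i(z)|^2}{K(z,z)},\qquad\forall z\in\Omega.$$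
   Context: A Hilbert space $\mathcal{H}_K$ of functions $f:\Omega\to\mathbb{C}$ is a reproducing kernel Hilbert space if for every $z\in\Omega$ the point evaluation $f\mapsto f(z)$ is bounded; then $f(z)=\langle f,k_z\rangle$ for a unique $k_z\in\mathcal{H}_K$, and the reproducing kernel is $K(z,w):=k_w(z)=\langle k_w,k_z\rangle$, so that $K(z,z)=\|k_z\|^2$. Sums of nonnegative terms may take the value $+\infty$ in (ii). *)

theory Defs
  imports "HOL-Analysis.Analysis"
begin

definition ip_norm :: "(('a \<Rightarrow> complex) \<Rightarrow> ('a \<Rightarrow> complex) \<Rightarrow> complex) \<Rightarrow> ('a \<Rightarrow> complex) \<Rightarrow> real" where
  "ip_norm ip f = sqrt (Re (ip f f))"

(* A function on the set \<Omega> is represented by its extension by zero to the whole type 'a,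
   so that equality of elements of H is equality of functions on \<Omega>.
   The form ip is linear in the first argument and is only constrained on H. *)
locale hilbert_function_space =
  fixes \<Omega> :: "'a set"
    and H :: "('a \<Rightarrow> complex) set"
    and ip :: "('a \<Rightarrow> complex) \<Rightarrow> ('a \<Rightarrow> complex) \<Rightarrow> complex"
  assumes zero_outside: "\<And>f z. f \<in> H \<Longrightarrow> z \<notin> \<Omega> \<Longrightarrow> f z = 0"
    and zero_mem: "(\<lambda>z. 0) \<in> H"
    and add_mem: "\<And>f g. f \<in> H \<Longrightarrow> g \<in> H \<Longrightarrow> (\<lambda>z. f z + g z) \<in> H"
    and scale_mem: "\<And>c f. f \<in> H \<Longrightarrow> (\<lambda>z. c * f z) \<in> H"
    and ip_add_left: "\<And>f g h. f \<in> H \<Longrightarrow> g \<in> H \<Longrightarrow> h \<in> H \<Longrightarrow>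
          ip (\<lambda>z. f z + g z) h = ip f h + ip g h"
    and ip_scale_left: "\<And>c f g. f \<in> H \<Longrightarrow> g \<in> H \<Longrightarrow> ip (\<lambda>z. c * f z) g = c * ip f g"
    and ip_commute: "\<And>f g. f \<in> H \<Longrightarrow> g \<in> H \<Longrightarrow> ip g f = cnj (ip f g)"
    and ip_nonneg: "\<And>f. f \<in> H \<Longrightarrow> 0 \<le> Re (ip f f)"
    and ip_definite: "\<And>f. f \<in> H \<Longrightarrow> ip f f = 0 \<Longrightarrow> f = (\<lambda>z. 0)"
    and complete: "\<And>X :: nat \<Rightarrow> 'a \<Rightarrow> complex. (\<And>n. X n \<in> H) \<Longrightarrow>
          (\<And>e. e > 0 \<Longrightarrow> \<exists>N. \<forall>m\<ge>N. \<forall>n\<ge>N. ip_norm ip (\<lambda>z. X m z - X n z) < e) \<Longrightarrow>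
          \<exists>f\<in>H. (\<lambda>n. ip_norm ip (\<lambda>z. X n z - f z)) \<longlonglongrightarrow> 0"

locale rkhs = hilbert_function_space +
  assumes bounded_eval: "\<And>z. z \<in> \<Omega> \<Longrightarrow> \<exists>C. \<forall>f\<in>H. cmod (f z) \<le> C * ip_norm ip f"

(* The representer k_w of evaluation at w. In an rkhs it exists and is unique for w in \<Omega>,
   by the Riesz representation theorem; elsewhere the value is irrelevant. *)
definition kernel_vec ::
  "('a \<Rightarrow> complex) set \<Rightarrow> (('a \<Rightarrow> complex) \<Rightarrow> ('a \<Rightarrow> complex) \<Rightarrow> complex) \<Rightarrow> 'a \<Rightarrow> ('a \<Rightarrow> complex)" where
  "kernel_vec H ip w = (THE k. k \<in> H \<and> (\<forall>f\<in>H. f w = ip f k))"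

definition rkernel ::
  "('a \<Rightarrow> complex) set \<Rightarrow> (('a \<Rightarrow> complex) \<Rightarrow> ('a \<Rightarrow> complex) \<Rightarrow> complex) \<Rightarrow> 'a \<Rightarrow> 'a \<Rightarrow> complex" where
  "rkernel H ip z w = kernel_vec H ip w z"

(* The sums are taken in the extended reals, where a sum of nonnegative terms always exists and
   may be infinite; a bound M or m is an arbitrary real and is not truncated at 0. *)
definition bessel_with_bound ::
  "('a \<Rightarrow> complex) set \<Rightarrow> (('a \<Rightarrow> complex) \<Rightarrow> ('a \<Rightarrow> complex) \<Rightarrow> complex) \<Rightarrow>
   'i set \<Rightarrow> ('i \<Rightarrow> 'a \<Rightarrow> complex) \<Rightarrow> real \<Rightarrow> bool" where
  "bessel_with_bound H ip I \<psi> M \<longleftrightarrow>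
     (\<forall>f\<in>H. (\<Sum>\<^sub>\<infinity>i\<in>I. ereal ((cmod (ip f (\<psi> i)))\<^sup>2)) \<le> ereal (M * (ip_norm ip f)\<^sup>2))"

definition lower_frame_with_bound ::
  "('a \<Rightarrow> complex) set \<Rightarrow> (('a \<Rightarrow> complex) \<Rightarrow> ('a \<Rightarrow> complex) \<Rightarrow> complex) \<Rightarrow>
   'i set \<Rightarrow> ('i \<Rightarrow> 'a \<Rightarrow> complex) \<Rightarrow> real \<Rightarrow> bool" where
  "lower_frame_with_bound H ip I \<psi> m \<longleftrightarrow>
     (\<forall>f\<in>H. ereal (m * (ip_norm ip f)\<^sup>2) \<le> (\<Sum>\<^sub>\<infinity>i\<in>I. ereal ((cmod (ip f (\<psi> i)))\<^sup>2)))"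

end

theory Submission
  imports Defs
begin

text \<open>The family (\<psi> i) is only tested on the representer k of evaluation at z:
  the inner product of k with \<psi> i is the conjugate of \<psi> i z, and the squared norm of k is K(z,z).
  The existence of k is the Riesz representation theorem. If evaluation at z is not zero, then an
  element of least norm among the f with f z = 1 is orthogonal to all g with g z = 0, and k is
  a multiple of it.\<close>

section \<open>Inner product algebra, Cauchy-Schwarz and the parallelogram law\<close>

context hilbert_function_space
begin

lemma lincomb_mem:
  assumes "f \<in> H" "g \<in> H"
  shows "(\<lambda>z. f z + c * g z) \<in> H"
  using add_mem[OF assms(1) scale_mem[OF assms(2)]] .

lemma diff_mem:
  assumes "f \<in> H" "g \<in> H"
  shows "(\<lambda>z. f z - g z) \<in> H"
  using lincomb_mem[OF assms, of "-1"] by simp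

lemma ip_lincomb_left:
  assumes "f \<in> H" "g \<in> H" "h \<in> H"
  shows "ip (\<lambda>z. f z + c * g z) h = ip f h + c * ip g h"
  using ip_add_left[OF assms(1) scale_mem[OF assms(2)] assms(3)]
        ip_scale_left[OF assms(2,3)] by simp

lemma ip_lincomb_right:
  assumes "f \<in> H" "g \<in> H" "h \<in> H"
  shows "ip h (\<lambda>z. f z + c * g z) = ip h f + cnj c * ip h g"
  using ip_commute[OF lincomb_mem[OF assms(1,2)] assms(3)] ip_lincomb_left[OF assms]
        ip_commute[OF assms(1,3)] ip_commute[OF assms(2,3)]
  by simp

lemma ip_diff_right:
  assumes "f \<in> H" "g \<in> H" "h \<in> H"
  shows "ip h (\<lambda>z. f z - g z) = ip h f - ip h g"
  using ip_lincomb_right[OF assms, of "-1"] by simp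

lemma ip_zero_left: "g \<in> H \<Longrightarrow> ip (\<lambda>z. 0) g = 0"
  using ip_scale_left[OF zero_mem, of g 0] by simp

lemma ip_zero_right: "g \<in> H \<Longrightarrow> ip g (\<lambda>z. 0) = 0"
  using ip_commute[OF zero_mem, of g] ip_zero_left by simp

lemma ip_self_real:
  assumes "f \<in> H"
  shows "ip f f = complex_of_real (Re (ip f f))"
proof -
  have "Im (ip f f) = Im (cnj (ip f f))"
    by (rule arg_cong[OF ip_commute[OF assms assms]])
  then show ?thesis by (simp add: complex_eq_iff)
qed

lemma ip_norm_sq: "f \<in> H \<Longrightarrow> (ip_norm ip f)\<^sup>2 = Re (ip f f)"
  by (simp add: ip_norm_def ip_nonneg)

text \<open>The two cross terms are conjugate to each other, so they add up to twice a real part.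
  Read as a quadratic in \<open>c\<close>, this is what \<open>near_minimizer_ip_le\<close>
  minimizes.\<close>

lemma ip_lincomb_self:
  assumes "f \<in> H" "g \<in> H"
  shows "Re (ip (\<lambda>z. f z + c * g z) (\<lambda>z. f z + c * g z))
         = Re (ip f f) + 2 * Re (c * ip g f) + (cmod c)\<^sup>2 * Re (ip g g)"
proof -
  have "ip (\<lambda>z. f z + c * g z) (\<lambda>z. f z + c * g z)
        = ip f f + cnj (c * ip g f) + c * ip g f + c * cnj c * ip g g"
    using ip_commute[OF assms(2,1)]
    by (simp add: ip_lincomb_left ip_lincomb_right assms lincomb_mem algebra_simps)
  also have "c * cnj c * ip g g = complex_of_real ((cmod c)\<^sup>2 * Re (ip g g))"
    by (subst ip_self_real[OF assms(2)]) (simp add: complex_mult_cnj cmod_power2)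
  finally show ?thesis by simp
qed

text \<open>For d = 0 this is the Cauchy-Schwarz inequality; for d the least value of the squared norm
  on an affine subspace it says that near-minimizers are nearly orthogonal to the directions.\<close>

lemma near_minimizer_ip_le:
  assumes f: "f \<in> H" and g: "g \<in> H"
    and lower: "\<And>c. d \<le> Re (ip (\<lambda>z. f z + c * g z) (\<lambda>z. f z + c * g z))"
  shows "(cmod (ip g f))\<^sup>2 \<le> (Re (ip f f) - d) * Re (ip g g)"
proof (cases "Re (ip g g) = 0")
  case True
  then have "g = (\<lambda>z. 0)"
    using ip_definite[OF g] ip_self_real[OF g] by (metis of_real_0)
  then show ?thesis using ip_zero_left[OF f] ip_zero_left[OF zero_mem] by simp
next
  case False
  define q where "q = Re (ip g g)"
  have q: "q > 0" using False ip_nonneg[OF g] unfolding q_def by simp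
  \<comment> \<open>This \<open>c\<close> minimizes the quadratic of \<open>ip_lincomb_self\<close>;
    completing the square lowers the squared norm of \<open>f\<close> by
    \<open>(cmod (ip g f))^2 / q\<close>.\<close>
  define c where "c = - cnj (ip g f) / complex_of_real q"
  have "c * ip g f = complex_of_real (- (cmod (ip g f))\<^sup>2 / q)"
    using complex_norm_square[of "ip g f"] by (simp add: c_def mult.commute)
  then have "Re (c * ip g f) = - (cmod (ip g f))\<^sup>2 / q" by (metis Re_complex_of_real)
  moreover have "(cmod c)\<^sup>2 * q = (cmod (ip g f))\<^sup>2 / q"
    using q by (simp add: c_def norm_divide power_divide power2_eq_square)
  ultimately have "d \<le> Re (ip f f) - (cmod (ip g f))\<^sup>2 / q"
    using lower[of c] ip_lincomb_self[OF f g, of c] unfolding q_def by simp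
  then have "(cmod (ip g f))\<^sup>2 / q \<le> Re (ip f f) - d" by simp
  then show ?thesis using q by (simp add: pos_divide_le_eq q_def[symmetric])
qed

lemma cauchy_schwarz:
  assumes f: "f \<in> H" and g: "g \<in> H"
  shows "cmod (ip g f) \<le> ip_norm ip g * ip_norm ip f"
proof -
  have "(cmod (ip g f))\<^sup>2 \<le> Re (ip f f) * Re (ip g g)"
    using near_minimizer_ip_le[OF f g, of 0] ip_nonneg[OF lincomb_mem[OF f g]] by simp
  then show ?thesis unfolding ip_norm_def
    by (metis real_le_rsqrt real_sqrt_mult mult.commute)
qed

lemma parallelogram:
  assumes f: "f \<in> H" and g: "g \<in> H"
  shows "Re (ip (\<lambda>z. f z - g z) (\<lambda>z. f z - g z)) + Re (ip (\<lambda>z. f z + g z) (\<lambda>z. f z + g z))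
         = 2 * Re (ip f f) + 2 * Re (ip g g)"
  using ip_lincomb_self[OF f g, of 1] ip_lincomb_self[OF f g, of "-1"] by simp

section \<open>Representers of point evaluations\<close>

lemma representer_unique:
  assumes k: "k \<in> H" "\<And>f. f \<in> H \<Longrightarrow> f w = ip f k"
    and l: "l \<in> H" "\<And>f. f \<in> H \<Longrightarrow> f w = ip f l"
  shows "k = l"
proof -
  have m: "(\<lambda>z. k z - l z) \<in> H" by (rule diff_mem[OF k(1) l(1)])
  \<comment> \<open>Both terms of the split inner product equal the value of the difference at
    \<open>w\<close>.\<close>
  have "ip (\<lambda>z. k z - l z) (\<lambda>z. k z - l z) = 0"
    using ip_diff_right[OF k(1) l(1) m] k(2)[OF m] l(2)[OF m] by simp
  from ip_definite[OF m this] show ?thesis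
    by (metis (no_types, lifting) eq_iff_diff_eq_0 ext)
qed

text \<open>A minimizing sequence is Cauchy by the parallelogram law and converges by completeness;
  the bound \<open>C\<close> makes evaluation continuous, so the constraint at \<open>w\<close>
  survives in the limit.\<close>

lemma representer_exists:
  assumes bd: "\<And>f. f \<in> H \<Longrightarrow> cmod (f w) \<le> C * ip_norm ip f"
  shows "\<exists>k\<in>H. \<forall>f\<in>H. f w = ip f k"
proof (cases "\<forall>f\<in>H. f w = 0")
  case True
  then show ?thesis using zero_mem ip_zero_right by (intro bexI[of _ "\<lambda>z. 0"]) auto
next
  case False
  then obtain f0 where f0: "f0 \<in> H" "f0 w \<noteq> 0" by blast
  define Q where "Q f = Re (ip f f)" for f
  define S where "S = {f \<in> H. f w = 1}"
  \<comment> \<open>The squared distance from the origin to the affine set \<open>S\<close>, which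
    is nonempty because \<open>f0\<close> can be rescaled.\<close>
  define d where "d = Inf (Q ` S)"
  have "(\<lambda>z. inverse (f0 w) * f0 z) \<in> S"
    unfolding S_def using f0 scale_mem by simp
  then have ne: "Q ` S \<noteq> {}" by blast
  have d_le: "d \<le> Q f" if "f \<in> S" for f
    unfolding d_def using that ip_nonneg
    by (intro cInf_lower bdd_belowI[of _ 0]) (auto simp: S_def Q_def)
  have "\<exists>f\<in>S. Q f < d + inverse (real (Suc n))" for n
    using cInf_lessD[OF ne, of "d + inverse (real (Suc n))"] unfolding d_def by fastforce
  then obtain X where X: "\<And>n. X n \<in> S" "\<And>n. Q (X n) < d + inverse (real (Suc n))"
    by metis
  have XH: "X n \<in> H" and Xw: "X n w = 1" for n using X(1) unfolding S_def by auto
  \<comment> \<open>The midpoint of two elements of \<open>S\<close> lies in \<open>S\<close>, so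
    their sum has squared norm at least \<open>4 * d\<close>. In the parallelogram law this cancels
    all but twice the two excesses over \<open>d\<close>.\<close>
  have diff: "Q (\<lambda>z. X m z - X n z) \<le> 2 * inverse (real (Suc m)) + 2 * inverse (real (Suc n))"
    for m n
  proof -
    have sH: "(\<lambda>z. X m z + X n z) \<in> H" by (rule add_mem[OF XH XH])
    have mid: "(\<lambda>z. 0 + (1/2) * (X m z + X n z)) \<in> S"
      unfolding S_def using lincomb_mem[OF zero_mem sH, of "1/2"] Xw by simp
    have "4 * d \<le> Q (\<lambda>z. X m z + X n z)"
      using d_le[OF mid] ip_lincomb_self[OF zero_mem sH, of "1/2"]
        ip_zero_left[OF zero_mem] ip_zero_right[OF sH]
      unfolding Q_def by (simp add: power2_eq_square)
    then show ?thesis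
      using parallelogram[OF XH XH, of m n] X(2)[of m] X(2)[of n] unfolding Q_def by linarith
  qed
  have "\<exists>f\<in>H. (\<lambda>n. ip_norm ip (\<lambda>z. X n z - f z)) \<longlonglongrightarrow> 0"
  proof (rule complete[OF XH])
    fix e :: real assume e: "e > 0"
    \<comment> \<open>Each of the two terms in \<open>diff\<close> is then below
      \<open>e^2 / 2\<close>.\<close>
    obtain N where N: "inverse (real (Suc N)) < e\<^sup>2 / 4"
      using reals_Archimedean[of "e\<^sup>2 / 4"] e by auto
    show "\<exists>N. \<forall>m\<ge>N. \<forall>n\<ge>N. ip_norm ip (\<lambda>z. X m z - X n z) < e"
    proof (intro exI[of _ N] allI impI)
      fix m n assume mn: "N \<le> m" "N \<le> n"
      have "inverse (real (Suc m)) \<le> inverse (real (Suc N))"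
           "inverse (real (Suc n)) \<le> inverse (real (Suc N))"
        using mn by (auto intro!: le_imp_inverse_le)
      then have "Q (\<lambda>z. X m z - X n z) < e\<^sup>2"
        using diff[of m n] N by linarith
      then show "ip_norm ip (\<lambda>z. X m z - X n z) < e"
        unfolding ip_norm_def Q_def using e by (intro real_less_lsqrt) auto
    qed
  qed
  then obtain f where f: "f \<in> H" and lim: "(\<lambda>n. ip_norm ip (\<lambda>z. X n z - f z)) \<longlonglongrightarrow> 0" by blast
  have fw: "f w = 1"
  proof -
    have "(\<lambda>n. C * ip_norm ip (\<lambda>z. X n z - f z)) \<longlonglongrightarrow> 0"
      using tendsto_mult_right_zero[OF lim] .
    moreover have "cmod (1 - f w) \<le> C * ip_norm ip (\<lambda>z. X n z - f z)" for n
      using bd[OF diff_mem[OF XH f]] Xw by simp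
    ultimately have "cmod (1 - f w) \<le> 0" by (intro LIMSEQ_le_const) auto
    then show ?thesis by simp
  qed
  \<comment> \<open>Adding multiples of \<open>g\<close> to \<open>X n\<close> stays in
    \<open>S\<close>, so \<open>near_minimizer_ip_le\<close> bounds \<open>ip g (X n)\<close>
    through the excess of \<open>X n\<close>. Cauchy-Schwarz controls the error of replacing
    \<open>X n\<close> by \<open>f\<close>, and both bounds tend to 0.\<close>
  have orth: "ip g f = 0" if g: "g \<in> H" and gw: "g w = 0" for g
  proof -
    have le: "cmod (ip g f) \<le> sqrt (inverse (real (Suc n)) * Q g)
                 + ip_norm ip g * ip_norm ip (\<lambda>z. X n z - f z)" for n
    proof -
      have "d \<le> Q (\<lambda>z. X n z + c * g z)" for c
        using lincomb_mem[OF XH g] Xw gw by (intro d_le) (auto simp: S_def)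
      then have "(cmod (ip g (X n)))\<^sup>2 \<le> (Q (X n) - d) * Q g"
        using near_minimizer_ip_le[OF XH g] unfolding Q_def by simp
      also have "\<dots> \<le> inverse (real (Suc n)) * Q g"
        using X(2)[of n] ip_nonneg[OF g] unfolding Q_def by (intro mult_right_mono) auto
      finally have "cmod (ip g (X n)) \<le> sqrt (inverse (real (Suc n)) * Q g)"
        by (rule real_le_rsqrt)
      moreover have "cmod (ip g (\<lambda>z. X n z - f z)) \<le> ip_norm ip g * ip_norm ip (\<lambda>z. X n z - f z)"
        by (rule cauchy_schwarz[OF diff_mem[OF XH f] g])
      moreover have "ip g f = ip g (X n) - ip g (\<lambda>z. X n z - f z)"
        using ip_diff_right[OF XH f g] by simp
      ultimately show ?thesis
        using norm_triangle_ineq4[of "ip g (X n)" "ip g (\<lambda>z. X n z - f z)"] by simp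
    qed
    have "(\<lambda>n. sqrt (inverse (real (Suc n)) * Q g)
             + ip_norm ip g * ip_norm ip (\<lambda>z. X n z - f z)) \<longlonglongrightarrow> sqrt (0 * Q g) + ip_norm ip g * 0"
      by (intro tendsto_intros LIMSEQ_inverse_real_of_nat lim)
    then have "cmod (ip g f) \<le> sqrt (0 * Q g) + ip_norm ip g * 0"
      using le by (intro LIMSEQ_le_const) auto
    then show ?thesis by simp
  qed
  have nz: "ip f f \<noteq> 0" using ip_definite[OF f] fw by fastforce
  \<comment> \<open>The factor is conjugated because \<open>ip\<close> is conjugate linear in its
    second argument; the leading \<open>0\<close> gives the form of a linear combination.\<close>
  define k where "k = (\<lambda>z. 0 + inverse (cnj (ip f f)) * f z)"
  have kH: "k \<in> H" unfolding k_def by (rule lincomb_mem[OF zero_mem f])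
  have "h w = ip h k" if h: "h \<in> H" for h
  proof -
    \<comment> \<open>Since \<open>f w = 1\<close>, subtracting \<open>h w\<close> times
      \<open>f\<close> from \<open>h\<close> gives a function vanishing at \<open>w\<close>.\<close>
    have "ip (\<lambda>z. h z + (- h w) * f z) f = 0"
      using orth[OF lincomb_mem[OF h f, of "- h w"]] fw by simp
    then have "ip h f = h w * ip f f"
      using ip_lincomb_left[OF h f f, of "- h w"] by simp
    then show ?thesis
      unfolding k_def using ip_lincomb_right[OF zero_mem f h] ip_zero_right[OF h] nz by simp
  qed
  then show ?thesis using kH by blast
qed

end

section \<open>The reproducing kernel and its pairing with a family\<close>

context rkhs
begin

text \<open>Existence and uniqueness together make the definite description in
  \<open>kernel_vec\<close> denote the representer; \<open>w \<in> \<Omega>\<close> supplies the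
  bound that existence rests on.\<close>

lemma
  assumes "w \<in> \<Omega>"
  shows kernel_vec_mem: "kernel_vec H ip w \<in> H"
    and kernel_vec_reproduces: "f \<in> H \<Longrightarrow> ip f (kernel_vec H ip w) = f w"
proof -
  obtain C where "\<And>f. f \<in> H \<Longrightarrow> cmod (f w) \<le> C * ip_norm ip f"
    using bounded_eval[OF assms] by blast
  from representer_exists[OF this]
  have "\<exists>!k. k \<in> H \<and> (\<forall>f\<in>H. f w = ip f k)"
    using representer_unique by blast
  from theI'[OF this]
  have "kernel_vec H ip w \<in> H \<and> (\<forall>f\<in>H. f w = ip f (kernel_vec H ip w))"
    unfolding kernel_vec_def .
  then show "kernel_vec H ip w \<in> H" "f \<in> H \<Longrightarrow> ip f (kernel_vec H ip w) = f w"
    by auto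
qed

text \<open>The representer reproduces its own value at \<open>w\<close>.\<close>

lemma rkernel_diag:
  assumes "w \<in> \<Omega>"
  shows "Re (rkernel H ip w w) = (ip_norm ip (kernel_vec H ip w))\<^sup>2"
  using kernel_vec_mem[OF assms] kernel_vec_reproduces[OF assms]
  by (simp add: rkernel_def ip_norm_sq)

lemma kernel_vec_analysis_sum:
  assumes "w \<in> \<Omega>" "\<And>i. i \<in> I \<Longrightarrow> \<psi> i \<in> H"
  shows "(\<Sum>\<^sub>\<infinity>i\<in>I. ereal ((cmod (ip (kernel_vec H ip w) (\<psi> i)))\<^sup>2))
         = (\<Sum>\<^sub>\<infinity>i\<in>I. ereal ((cmod (\<psi> i w))\<^sup>2))"
proof (rule infsum_cong)
  fix i assume "i \<in> I"
  then have "ip (kernel_vec H ip w) (\<psi> i) = cnj (\<psi> i w)"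
    using ip_commute[OF assms(2) kernel_vec_mem[OF assms(1)]] kernel_vec_reproduces[OF assms(1)]
      assms(2) by simp
  then show "ereal ((cmod (ip (kernel_vec H ip w) (\<psi> i)))\<^sup>2) = ereal ((cmod (\<psi> i w))\<^sup>2)"
    by simp
qed

end

theorem proposition6:
  fixes \<Omega> :: "'a set"
    and H :: "('a \<Rightarrow> complex) set"
    and ip :: "('a \<Rightarrow> complex) \<Rightarrow> ('a \<Rightarrow> complex) \<Rightarrow> complex"
    and I :: "'i set"
    and \<psi> :: "'i \<Rightarrow> 'a \<Rightarrow> complex"
  assumes "rkhs \<Omega> H ip"
    and "\<And>z. z \<in> \<Omega> \<Longrightarrow> 0 < Re (rkernel H ip z z)"
    and "countable I"
    and "\<And>i. i \<in> I \<Longrightarrow> \<psi> i \<in> H"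
  shows "(\<forall>M :: real. bessel_with_bound H ip I \<psi> M \<longrightarrow>
            (\<forall>z\<in>\<Omega>. (\<Sum>\<^sub>\<infinity>i\<in>I. ereal ((cmod (\<psi> i z))\<^sup>2)) / ereal (Re (rkernel H ip z z)) \<le> ereal M))
       \<and> (\<forall>m :: real. 0 < m \<longrightarrow> lower_frame_with_bound H ip I \<psi> m \<longrightarrow>
            (\<forall>z\<in>\<Omega>. 0 < m \<and>
               ereal m \<le> (\<Sum>\<^sub>\<infinity>i\<in>I. ereal ((cmod (\<psi> i z))\<^sup>2)) / ereal (Re (rkernel H ip z z))))"
proof -
  interpret rkhs \<Omega> H ip by fact
  have sum: "(\<Sum>\<^sub>\<infinity>i\<in>I. ereal ((cmod (ip (kernel_vec H ip z) (\<psi> i)))\<^sup>2))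
      = (\<Sum>\<^sub>\<infinity>i\<in>I. ereal ((cmod (\<psi> i z))\<^sup>2))" if "z \<in> \<Omega>" for z
    using that assms(4) by (rule kernel_vec_analysis_sum)
  show ?thesis
  proof (intro conjI allI impI ballI)
    fix M z assume bessel: "bessel_with_bound H ip I \<psi> M" and z: "z \<in> \<Omega>"
    have "(\<Sum>\<^sub>\<infinity>i\<in>I. ereal ((cmod (\<psi> i z))\<^sup>2)) \<le> ereal (M * Re (rkernel H ip z z))"
      using bessel[unfolded bessel_with_bound_def, rule_format, OF kernel_vec_mem[OF z]]
      unfolding sum[OF z] rkernel_diag[OF z] .
    then show "(\<Sum>\<^sub>\<infinity>i\<in>I. ereal ((cmod (\<psi> i z))\<^sup>2)) / ereal (Re (rkernel H ip z z)) \<le> ereal M"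
      using assms(2)[OF z] by (simp add: ereal_divide_le_pos mult.commute)
  next
    fix m z assume lower: "lower_frame_with_bound H ip I \<psi> m" and z: "z \<in> \<Omega>"
    have "ereal (m * Re (rkernel H ip z z)) \<le> (\<Sum>\<^sub>\<infinity>i\<in>I. ereal ((cmod (\<psi> i z))\<^sup>2))"
      using lower[unfolded lower_frame_with_bound_def, rule_format, OF kernel_vec_mem[OF z]]
      unfolding sum[OF z] rkernel_diag[OF z] .
    \<comment> \<open>The sum may be infinite; division by the positive real
      \<open>Re (rkernel H ip z z)\<close> still respects the order of the extended reals.\<close>
    then show "ereal m \<le> (\<Sum>\<^sub>\<infinity>i\<in>I. ereal ((cmod (\<psi> i z))\<^sup>2)) / ereal (Re (rkernel H ip z z))"
      using assms(2)[OF z] by (simp add: ereal_le_divide_pos mult.commute)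
  qed
qed

end
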